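(* Let $T,T'\colon\mathcal{A}\times\mathcal{B}\to\mathcal{C}$ and $H,H'\colon\mathcal{A}^{\mathrm{op}}\times\mathcal{C}\to\mathcal{B}$ be functors forming left-sided adjunctions of two variables $T\dashv_{\mathrm{L}}H$ (counit $\epsilon$, unit $\eta$) and $T'\dashv_{\mathrm{L}}H'$ (counit $\epsilon'$, unit $\eta'$). Then the two conjugation maps between sets of natural transformations $$j_{\mathrm{l}}\colon\mathrm{Nat}(T,T')\to\mathrm{Nat}(H',H),\qquad j_{\mathrm{r}}\colon\mathrm{Nat}(H',H)\to\mathrm{Nat}(T,T')$$ are mutually inverse.
   Context: A left-sided adjunction of two variables $T\dashv_{\mathrm{L}}H$ consists of functors $T\colon\mathcal{A}\times\mathcal{B}\to\mathcal{C}$ and $H\colon\mathcal{A}^{\mathrm{op}}\times\mathcal{C}\to\mathcal{B}$ and families of morphisms $\epsilon_{a,c}\colon T(a,H(a,c))\to c$ (counit) and $\eta_{a,b}\colon b\to H(a,T(a,b))$ (unit) such that: $\epsilon_{a,c}$ is natural in $c$ and $\eta_{a,b}$ is natural in $b$; they are extranatural in $a$, meaning that for every $f\colon a\to a'$ in $\mathcal{A}$, $\epsilon_{a,c}\circ T(a,H(f,c))=\epsilon_{a',c}\circ T(f,H(a',c))$ and $H(f,T(a',b))\circ\eta_{a',b}=H(a,T(f,b))\circ\eta_{a,b}$; and the triangle identities $H(a,\epsilon_{a,c})\circ\eta_{a,H(a,c)}=\mathrm{id}_{H(a,c)}$ and $\epsilon_{a,T(a,b)}\circ T(a,\eta_{a,b})=\mathrm{id}_{T(a,b)}$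 hold. Conjugation: for $\theta\colon T\Rightarrow T'$, $j_{\mathrm{l}}(\theta)\colon H'\Rightarrow H$ has components $$H'(a,c)\xrightarrow{\eta_{a,H'(a,c)}}H(a,T(a,H'(a,c)))\xrightarrow{H(a,\theta_{a,H'(a,c)})}H(a,T'(a,H'(a,c)))\xrightarrow{H(a,\epsilon'_{a,c})}H(a,c).$$ For $\phi\colon H'\Rightarrow H$, $j_{\mathrm{r}}(\phi)\colon T\Rightarrow T'$ has components $$T(a,b)\xrightarrow{T(a,\eta'_{a,b})}T(a,H'(a,T'(a,b)))\xrightarrow{T(a,\phi_{a,T'(a,b)})}T(a,H(a,T'(a,b)))\xrightarrow{\epsilon_{a,T'(a,b)}}T'(a,b).$$ *)

theory Defs
  imports Main "HOL-Library.FuncSet"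
begin

section \<open>Categories\<close>

record ('o, 'm) category =
  Ob :: "'o set"
  Ar :: "'m set"
  Dom :: "'m \<Rightarrow> 'o"
  Cod :: "'m \<Rightarrow> 'o"
  Ide :: "'o \<Rightarrow> 'm"
  Comp :: "'m \<Rightarrow> 'm \<Rightarrow> 'm"  (infixl "\<cdot>\<index>" 70)

text \<open>Composition is written in the classical order, \<open>g \<cdot> f\<close> meaning "\<open>f\<close>, then \<open>g\<close>".
  Its value is unconstrained on pairs of arrows that are not composable.\<close>

definition hom :: "('o, 'm) category \<Rightarrow> 'o \<Rightarrow> 'o \<Rightarrow> 'm set" where
  "hom C x y = {f \<in> Ar C. Dom C f = x \<and> Cod C f = y}"

locale category =
  fixes C :: "('o, 'm) category" (structure)
  assumes dom_in_Ob: "f \<in> Ar C \<Longrightarrow> Dom C f \<in> Ob C"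
    and cod_in_Ob: "f \<in> Ar C \<Longrightarrow> Cod C f \<in> Ob C"
    and ide_in_hom: "x \<in> Ob C \<Longrightarrow> Ide C x \<in> hom C x x"
    and comp_in_hom: "\<lbrakk>f \<in> hom C x y; g \<in> hom C y z\<rbrakk> \<Longrightarrow> g \<cdot> f \<in> hom C x z"
    and comp_ide_right: "f \<in> hom C x y \<Longrightarrow> f \<cdot> Ide C x = f"
    and comp_ide_left: "f \<in> hom C x y \<Longrightarrow> Ide C y \<cdot> f = f"
    and comp_assoc: "\<lbrakk>f \<in> hom C w x; g \<in> hom C x y; h \<in> hom C y z\<rbrakk>
      \<Longrightarrow> h \<cdot> (g \<cdot> f) = (h \<cdot> g) \<cdot> f"

definition op_cat :: "('o, 'm) category \<Rightarrow> ('o, 'm) category" where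
  "op_cat C = \<lparr>Ob = Ob C, Ar = Ar C, Dom = Cod C, Cod = Dom C, Ide = Ide C,
    Comp = (\<lambda>g f. f \<cdot>\<^bsub>C\<^esub> g)\<rparr>"

definition prod_cat ::
  "('o1, 'm1) category \<Rightarrow> ('o2, 'm2) category \<Rightarrow> ('o1 \<times> 'o2, 'm1 \<times> 'm2) category"
  where
  "prod_cat C D = \<lparr>Ob = Ob C \<times> Ob D, Ar = Ar C \<times> Ar D,
    Dom = map_prod (Dom C) (Dom D), Cod = map_prod (Cod C) (Cod D),
    Ide = map_prod (Ide C) (Ide D),
    Comp = (\<lambda>(g, g') (f, f'). (g \<cdot>\<^bsub>C\<^esub> f, g' \<cdot>\<^bsub>D\<^esub> f'))\<rparr>"

lemma category_op_cat:
  assumes "category C"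
  shows "category (op_cat C)"
proof -
  interpret category C by fact
  show ?thesis
    by unfold_locales
      (use dom_in_Ob cod_in_Ob ide_in_hom comp_in_hom comp_ide_right comp_ide_left comp_assoc
        in \<open>auto simp: op_cat_def hom_def\<close>)
qed

lemma category_prod_cat:
  assumes "category C" and "category D"
  shows "category (prod_cat C D)"
proof -
  interpret C: category C by fact
  interpret D: category D by fact
  show ?thesis
    by unfold_locales
      (use C.dom_in_Ob C.cod_in_Ob C.ide_in_hom C.comp_in_hom C.comp_ide_right C.comp_ide_left
        C.comp_assoc D.dom_in_Ob D.cod_in_Ob D.ide_in_hom D.comp_in_hom D.comp_ide_right
        D.comp_ide_left D.comp_assoc
        in \<open>auto simp: prod_cat_def hom_def\<close>)
qed

section \<open>Functors and natural transformations\<close>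

record ('o, 'm, 'p, 'n) cat_functor =
  obj_map :: "'o \<Rightarrow> 'p"  (infixl "\<bullet>\<^sub>o" 90)
  arr_map :: "'m \<Rightarrow> 'n"  (infixl "\<bullet>\<^sub>a" 90)

locale is_functor =
  dom: category C + cod: category D
  for C :: "('o, 'm) category" and D :: "('p, 'n) category"
    and F :: "('o, 'm, 'p, 'n) cat_functor" +
  assumes obj_map_in_Ob: "x \<in> Ob C \<Longrightarrow> F \<bullet>\<^sub>o x \<in> Ob D"
    and arr_map_in_hom: "f \<in> hom C x y \<Longrightarrow> F \<bullet>\<^sub>a f \<in> hom D (F \<bullet>\<^sub>o x) (F \<bullet>\<^sub>o y)"
    and arr_map_ide: "x \<in> Ob C \<Longrightarrow> F \<bullet>\<^sub>a Ide C x = Ide D (F \<bullet>\<^sub>o x)"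
    and arr_map_comp: "\<lbrakk>f \<in> hom C x y; g \<in> hom C y z\<rbrakk>
      \<Longrightarrow> F \<bullet>\<^sub>a (g \<cdot>\<^bsub>C\<^esub> f) = (F \<bullet>\<^sub>a g) \<cdot>\<^bsub>D\<^esub> (F \<bullet>\<^sub>a f)"

text \<open>Families of components are required to be \<^const>\<open>extensional\<close>, so that equality in
  \<open>nat_trans C D F G\<close> is equality of all components at objects of \<open>C\<close>.\<close>

definition nat_trans :: "('o, 'm) category \<Rightarrow> ('p, 'n) category \<Rightarrow>
    ('o, 'm, 'p, 'n) cat_functor \<Rightarrow> ('o, 'm, 'p, 'n) cat_functor \<Rightarrow> ('o \<Rightarrow> 'n) set" where
  "nat_trans C D F G = {\<theta> \<in> extensional (Ob C).
    (\<forall>x \<in> Ob C. \<theta> x \<in> hom D (F \<bullet>\<^sub>o x) (G \<bullet>\<^sub>o x)) \<and>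
    (\<forall>x \<in> Ob C. \<forall>y \<in> Ob C. \<forall>f \<in> hom C x y.
      \<theta> y \<cdot>\<^bsub>D\<^esub> (F \<bullet>\<^sub>a f) = (G \<bullet>\<^sub>a f) \<cdot>\<^bsub>D\<^esub> \<theta> x)}"

section \<open>Left-sided adjunctions of two variables\<close>

text \<open>An object in an argument of a bifunctor on arrows stands for its identity:
  \<open>T(a, g)\<close> is \<open>T \<bullet>\<^sub>a (Ide A a, g)\<close>. An arrow \<open>f \<in> hom A a a'\<close> is an arrow from \<open>a'\<close> to \<open>a\<close>
  in \<open>op_cat A\<close>, so that \<open>H(f, c)\<close> is an arrow from \<open>H(a', c)\<close> to \<open>H(a, c)\<close>.\<close>

locale left_adjunction2 =
  A: category A + B: category B + C: category C +
  left: is_functor "prod_cat A B" C T + right: is_functor "prod_cat (op_cat A) C" B H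
  for A :: "('oa, 'ma) category" and B :: "('ob, 'mb) category" and C :: "('oc, 'mc) category"
    and T :: "('oa \<times> 'ob, 'ma \<times> 'mb, 'oc, 'mc) cat_functor"
    and H :: "('oa \<times> 'oc, 'ma \<times> 'mc, 'ob, 'mb) cat_functor"
    and \<epsilon> :: "'oa \<times> 'oc \<Rightarrow> 'mc"
    and \<eta> :: "'oa \<times> 'ob \<Rightarrow> 'mb" +
  assumes counit_in_hom: "\<lbrakk>a \<in> Ob A; c \<in> Ob C\<rbrakk>
      \<Longrightarrow> \<epsilon> (a, c) \<in> hom C (T \<bullet>\<^sub>o (a, H \<bullet>\<^sub>o (a, c))) c"
    and unit_in_hom: "\<lbrakk>a \<in> Ob A; b \<in> Ob B\<rbrakk>
      \<Longrightarrow> \<eta> (a, b) \<in> hom B b (H \<bullet>\<^sub>o (a, T \<bullet>\<^sub>o (a, b)))"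
    and counit_natural: "\<lbrakk>a \<in> Ob A; h \<in> hom C c c'\<rbrakk>
      \<Longrightarrow> \<epsilon> (a, c') \<cdot>\<^bsub>C\<^esub> T \<bullet>\<^sub>a (Ide A a, H \<bullet>\<^sub>a (Ide A a, h)) = h \<cdot>\<^bsub>C\<^esub> \<epsilon> (a, c)"
    and unit_natural: "\<lbrakk>a \<in> Ob A; g \<in> hom B b b'\<rbrakk>
      \<Longrightarrow> \<eta> (a, b') \<cdot>\<^bsub>B\<^esub> g = H \<bullet>\<^sub>a (Ide A a, T \<bullet>\<^sub>a (Ide A a, g)) \<cdot>\<^bsub>B\<^esub> \<eta> (a, b)"
    and counit_extranatural: "\<lbrakk>f \<in> hom A a a'; c \<in> Ob C\<rbrakk>
      \<Longrightarrow> \<epsilon> (a, c) \<cdot>\<^bsub>C\<^esub> T \<bullet>\<^sub>a (Ide A a, H \<bullet>\<^sub>a (f, Ide C c))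
        = \<epsilon> (a', c) \<cdot>\<^bsub>C\<^esub> T \<bullet>\<^sub>a (f, Ide B (H \<bullet>\<^sub>o (a', c)))"
    and unit_extranatural: "\<lbrakk>f \<in> hom A a a'; b \<in> Ob B\<rbrakk>
      \<Longrightarrow> H \<bullet>\<^sub>a (f, Ide C (T \<bullet>\<^sub>o (a', b))) \<cdot>\<^bsub>B\<^esub> \<eta> (a', b)
        = H \<bullet>\<^sub>a (Ide A a, T \<bullet>\<^sub>a (f, Ide B b)) \<cdot>\<^bsub>B\<^esub> \<eta> (a, b)"
    and triangle_right: "\<lbrakk>a \<in> Ob A; c \<in> Ob C\<rbrakk>
      \<Longrightarrow> H \<bullet>\<^sub>a (Ide A a, \<epsilon> (a, c)) \<cdot>\<^bsub>B\<^esub> \<eta> (a, H \<bullet>\<^sub>o (a, c)) = Ide B (H \<bullet>\<^sub>o (a, c))"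
    and triangle_left: "\<lbrakk>a \<in> Ob A; b \<in> Ob B\<rbrakk>
      \<Longrightarrow> \<epsilon> (a, T \<bullet>\<^sub>o (a, b)) \<cdot>\<^bsub>C\<^esub> T \<bullet>\<^sub>a (Ide A a, \<eta> (a, b)) = Ide C (T \<bullet>\<^sub>o (a, b))"

section \<open>Conjugation\<close>

definition conj_left ::
  "('oa, 'ma) category \<Rightarrow> ('ob, 'mb) category \<Rightarrow> ('oc, 'mc) category \<Rightarrow>
   ('oa \<times> 'oc, 'ma \<times> 'mc, 'ob, 'mb) cat_functor \<Rightarrow> ('oa \<times> 'ob \<Rightarrow> 'mb) \<Rightarrow>
   ('oa \<times> 'oc, 'ma \<times> 'mc, 'ob, 'mb) cat_functor \<Rightarrow> ('oa \<times> 'oc \<Rightarrow> 'mc) \<Rightarrow>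
   ('oa \<times> 'ob \<Rightarrow> 'mc) \<Rightarrow> ('oa \<times> 'oc \<Rightarrow> 'mb)" where
  "conj_left A B C H \<eta> H' \<epsilon>' \<theta> = (\<lambda>(a, c) \<in> Ob A \<times> Ob C.
     H \<bullet>\<^sub>a (Ide A a, \<epsilon>' (a, c)) \<cdot>\<^bsub>B\<^esub> H \<bullet>\<^sub>a (Ide A a, \<theta> (a, H' \<bullet>\<^sub>o (a, c)))
       \<cdot>\<^bsub>B\<^esub> \<eta> (a, H' \<bullet>\<^sub>o (a, c)))"

definition conj_right ::
  "('oa, 'ma) category \<Rightarrow> ('ob, 'mb) category \<Rightarrow> ('oc, 'mc) category \<Rightarrow>
   ('oa \<times> 'ob, 'ma \<times> 'mb, 'oc, 'mc) cat_functor \<Rightarrow> ('oa \<times> 'oc \<Rightarrow> 'mc) \<Rightarrow>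
   ('oa \<times> 'ob, 'ma \<times> 'mb, 'oc, 'mc) cat_functor \<Rightarrow> ('oa \<times> 'ob \<Rightarrow> 'mb) \<Rightarrow>
   ('oa \<times> 'oc \<Rightarrow> 'mb) \<Rightarrow> ('oa \<times> 'ob \<Rightarrow> 'mc)" where
  "conj_right A B C T \<epsilon> T' \<eta>' \<phi> = (\<lambda>(a, b) \<in> Ob A \<times> Ob B.
     \<epsilon> (a, T' \<bullet>\<^sub>o (a, b)) \<cdot>\<^bsub>C\<^esub> T \<bullet>\<^sub>a (Ide A a, \<phi> (a, T' \<bullet>\<^sub>o (a, b)))
       \<cdot>\<^bsub>C\<^esub> T \<bullet>\<^sub>a (Ide A a, \<eta>' (a, b)))"

end

theory Submission
  imports Defs
begin

text \<open>For each object \<open>a\<close>, unit and counit make \<open>g \<mapsto> H(a, g) \<circ> \<eta>\<close> and \<open>m \<mapsto> \<epsilon> \<circ> T(a, m)\<close> mutually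
  inverse bijections between arrows \<open>T(a, b) \<rightarrow> c\<close> and arrows \<open>b \<rightarrow> H(a, c)\<close> (lemmas
  \<open>left_transpose_right_transpose\<close> and \<open>right_transpose_left_transpose\<close>). Naturality and
  extranaturality of the unit together say that transposition is natural in \<open>a\<close>, \<open>b\<close> and \<open>c\<close>
  simultaneously (\<open>right_transpose_natural\<close>), and by bijectivity the same holds for the inverse.

  In these terms \<open>j\<^sub>l(\<theta>)\<close> is the transpose of \<open>\<epsilon>' \<circ> \<theta>\<close> and \<open>j\<^sub>r(\<phi>)\<close> is the transpose of
  \<open>\<phi> \<circ> \<eta>'\<close>. Conjugation is then what the Yoneda lemma predicts: precomposition of arrows
  \<open>T'(a, b) \<rightarrow> c\<close> with \<open>\<theta>\<close> corresponds under the two transpositions to postcomposition of arrows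
  \<open>b \<rightarrow> H'(a, c)\<close> with \<open>j\<^sub>l(\<theta>)\<close>, and similarly for \<open>j\<^sub>r\<close> (\<open>conj_left_right_transpose\<close> and
  \<open>left_transpose_conj_right\<close>). Evaluating at identities shows that \<open>j\<^sub>l\<close> and \<open>j\<^sub>r\<close> are mutually
  inverse; evaluating at the arrows that represent \<open>H'(f, h)\<close> and \<open>T'(f, k)\<close> shows that the
  conjugates are natural.\<close>

section \<open>Arrows of opposite and product categories\<close>

lemma (in category) hom_Ob:
  assumes "f \<in> hom C x y"
  shows "x \<in> Ob C" and "y \<in> Ob C"
  using assms dom_in_Ob cod_in_Ob by (auto simp: hom_def)

lemma hom_op_cat [simp]: "hom (op_cat C) x y = hom C y x"
  by (auto simp: hom_def op_cat_def)

lemma hom_prod_cat [simp]: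
  "hom (prod_cat C D) x y = hom C (fst x) (fst y) \<times> hom D (snd x) (snd y)"
  by (auto simp: hom_def prod_cat_def)

lemma op_cat_simps [simp]:
  "Ob (op_cat C) = Ob C" "Ide (op_cat C) = Ide C" "g \<cdot>\<^bsub>op_cat C\<^esub> f = f \<cdot>\<^bsub>C\<^esub> g"
  by (simp_all add: op_cat_def)

lemma prod_cat_simps [simp]:
  "Ob (prod_cat C D) = Ob C \<times> Ob D" "Ide (prod_cat C D) (x, y) = (Ide C x, Ide D y)"
  "(g, g') \<cdot>\<^bsub>prod_cat C D\<^esub> (f, f') = (g \<cdot>\<^bsub>C\<^esub> f, g' \<cdot>\<^bsub>D\<^esub> f')"
  by (simp_all add: prod_cat_def)

section \<open>Transposition\<close>

context left_adjunction2
begin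

lemma T_Ob: "\<lbrakk>a \<in> Ob A; b \<in> Ob B\<rbrakk> \<Longrightarrow> T \<bullet>\<^sub>o (a, b) \<in> Ob C"
  using left.obj_map_in_Ob[of "(a, b)"] by simp

lemma H_Ob: "\<lbrakk>a \<in> Ob A; c \<in> Ob C\<rbrakk> \<Longrightarrow> H \<bullet>\<^sub>o (a, c) \<in> Ob B"
  using right.obj_map_in_Ob[of "(a, c)"] by simp

lemma T_hom:
  "\<lbrakk>f \<in> hom A a a'; g \<in> hom B b b'\<rbrakk> \<Longrightarrow> T \<bullet>\<^sub>a (f, g) \<in> hom C (T \<bullet>\<^sub>o (a, b)) (T \<bullet>\<^sub>o (a', b'))"
  using left.arr_map_in_hom[of "(f, g)" "(a, b)" "(a', b')"] by simp

lemma H_hom: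
  "\<lbrakk>f \<in> hom A a a'; h \<in> hom C c c'\<rbrakk> \<Longrightarrow> H \<bullet>\<^sub>a (f, h) \<in> hom B (H \<bullet>\<^sub>o (a', c)) (H \<bullet>\<^sub>o (a, c'))"
  using right.arr_map_in_hom[of "(f, h)" "(a', c)" "(a, c')"] by simp

lemma T_ide: "\<lbrakk>a \<in> Ob A; b \<in> Ob B\<rbrakk> \<Longrightarrow> T \<bullet>\<^sub>a (Ide A a, Ide B b) = Ide C (T \<bullet>\<^sub>o (a, b))"
  using left.arr_map_ide[of "(a, b)"] by simp

lemma H_ide: "\<lbrakk>a \<in> Ob A; c \<in> Ob C\<rbrakk> \<Longrightarrow> H \<bullet>\<^sub>a (Ide A a, Ide C c) = Ide B (H \<bullet>\<^sub>o (a, c))"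
  using right.arr_map_ide[of "(a, c)"] by simp

lemma T_comp:
  "\<lbrakk>f \<in> hom A a a'; f' \<in> hom A a' a''; g \<in> hom B b b'; g' \<in> hom B b' b''\<rbrakk>
    \<Longrightarrow> T \<bullet>\<^sub>a (f' \<cdot>\<^bsub>A\<^esub> f, g' \<cdot>\<^bsub>B\<^esub> g) = T \<bullet>\<^sub>a (f', g') \<cdot>\<^bsub>C\<^esub> T \<bullet>\<^sub>a (f, g)"
  using left.arr_map_comp[of "(f, g)" "(a, b)" "(a', b')" "(f', g')" "(a'', b'')"] by simp

lemma H_comp:
  "\<lbrakk>f \<in> hom A a a'; f' \<in> hom A a' a''; h \<in> hom C c c'; h' \<in> hom C c' c''\<rbrakk>
    \<Longrightarrow> H \<bullet>\<^sub>a (f' \<cdot>\<^bsub>A\<^esub> f, h' \<cdot>\<^bsub>C\<^esub> h) = H \<bullet>\<^sub>a (f, h') \<cdot>\<^bsub>B\<^esub> H \<bullet>\<^sub>a (f', h)"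
  using right.arr_map_comp[of "(f', h)" "(a'', c)" "(a', c')" "(f, h')" "(a, c'')"] by simp

lemma T_comp_right:
  assumes "a \<in> Ob A" and "g \<in> hom B b b'" and "g' \<in> hom B b' b''"
  shows "T \<bullet>\<^sub>a (Ide A a, g' \<cdot>\<^bsub>B\<^esub> g) = T \<bullet>\<^sub>a (Ide A a, g') \<cdot>\<^bsub>C\<^esub> T \<bullet>\<^sub>a (Ide A a, g)"
  using T_comp[OF A.ide_in_hom A.ide_in_hom assms(2,3), of a] assms(1)
  by (simp add: A.comp_ide_left[OF A.ide_in_hom])

lemma H_comp_right:
  assumes "a \<in> Ob A" and "h \<in> hom C c c'" and "h' \<in> hom C c' c''"
  shows "H \<bullet>\<^sub>a (Ide A a, h' \<cdot>\<^bsub>C\<^esub> h) = H \<bullet>\<^sub>a (Ide A a, h') \<cdot>\<^bsub>B\<^esub> H \<bullet>\<^sub>a (Ide A a, h)"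
  using H_comp[OF A.ide_in_hom A.ide_in_hom assms(2,3), of a] assms(1)
  by (simp add: A.comp_ide_left[OF A.ide_in_hom])

lemma T_split:
  assumes "f \<in> hom A a a'" and "g \<in> hom B b b'"
  shows "T \<bullet>\<^sub>a (f, g) = T \<bullet>\<^sub>a (f, Ide B b') \<cdot>\<^bsub>C\<^esub> T \<bullet>\<^sub>a (Ide A a, g)"
proof -
  have "a \<in> Ob A" "b' \<in> Ob B"
    using assms A.hom_Ob B.hom_Ob by blast+
  then show ?thesis
    using T_comp[OF A.ide_in_hom assms(1,2) B.ide_in_hom] assms
    by (simp add: A.comp_ide_right B.comp_ide_left)
qed

lemma H_split:
  assumes "f \<in> hom A a a'" and "h \<in> hom C c c'"
  shows "H \<bullet>\<^sub>a (f, h) = H \<bullet>\<^sub>a (Ide A a, h) \<cdot>\<^bsub>B\<^esub> H \<bullet>\<^sub>a (f, Ide C c)"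
proof -
  have "a \<in> Ob A" "c \<in> Ob C"
    using assms A.hom_Ob C.hom_Ob by blast+
  then show ?thesis
    using H_comp[OF A.ide_in_hom assms(1) C.ide_in_hom assms(2)] assms
    by (simp add: A.comp_ide_right C.comp_ide_right)
qed

definition right_transpose :: "'oa \<Rightarrow> 'ob \<Rightarrow> 'mc \<Rightarrow> 'mb" where
  "right_transpose a b g = H \<bullet>\<^sub>a (Ide A a, g) \<cdot>\<^bsub>B\<^esub> \<eta> (a, b)"

definition left_transpose :: "'oa \<Rightarrow> 'oc \<Rightarrow> 'mb \<Rightarrow> 'mc" where
  "left_transpose a c m = \<epsilon> (a, c) \<cdot>\<^bsub>C\<^esub> T \<bullet>\<^sub>a (Ide A a, m)"

lemma right_transpose_hom:
  assumes "a \<in> Ob A" and "b \<in> Ob B" and "g \<in> hom C (T \<bullet>\<^sub>o (a, b)) c"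
  shows "right_transpose a b g \<in> hom B b (H \<bullet>\<^sub>o (a, c))"
  unfolding right_transpose_def
  using B.comp_in_hom[OF unit_in_hom H_hom[OF A.ide_in_hom]] assms by blast

lemma left_transpose_hom:
  assumes "a \<in> Ob A" and "c \<in> Ob C" and "m \<in> hom B b (H \<bullet>\<^sub>o (a, c))"
  shows "left_transpose a c m \<in> hom C (T \<bullet>\<^sub>o (a, b)) c"
  unfolding left_transpose_def
  using C.comp_in_hom[OF T_hom[OF A.ide_in_hom] counit_in_hom] assms by blast

lemma right_transpose_ide:
  assumes "a \<in> Ob A" and "b \<in> Ob B"
  shows "right_transpose a b (Ide C (T \<bullet>\<^sub>o (a, b))) = \<eta> (a, b)"
  unfolding right_transpose_def
  using assms by (simp add: H_ide T_Ob B.comp_ide_left[OF unit_in_hom])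

lemma left_transpose_ide:
  assumes "a \<in> Ob A" and "c \<in> Ob C"
  shows "left_transpose a c (Ide B (H \<bullet>\<^sub>o (a, c))) = \<epsilon> (a, c)"
  unfolding left_transpose_def
  using assms by (simp add: T_ide H_Ob C.comp_ide_right[OF counit_in_hom])

text \<open>Naturality of the unit moves \<open>k\<close> across \<open>\<eta>\<close>, and extranaturality trades \<open>T(f, b)\<close> inside
  \<open>H(a, -)\<close> for \<open>H(f, -)\<close> outside; functoriality of \<open>H\<close> does the rest.\<close>

lemma right_transpose_natural:
  assumes f: "f \<in> hom A a a'" and k: "k \<in> hom B b' b"
    and g: "g \<in> hom C (T \<bullet>\<^sub>o (a', b)) c" and h: "h \<in> hom C c c'"
  shows "right_transpose a b' (h \<cdot>\<^bsub>C\<^esub> g \<cdot>\<^bsub>C\<^esub> T \<bullet>\<^sub>a (f, k))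
    = H \<bullet>\<^sub>a (f, h) \<cdot>\<^bsub>B\<^esub> right_transpose a' b g \<cdot>\<^bsub>B\<^esub> k"
proof -
  have ob: "a \<in> Ob A" "a' \<in> Ob A" "b \<in> Ob B" "b' \<in> Ob B" "c \<in> Ob C" "c' \<in> Ob C"
    using assms A.hom_Ob B.hom_Ob C.hom_Ob by blast+
  note ide = A.ide_in_hom[OF ob(1)] A.ide_in_hom[OF ob(2)] B.ide_in_hom[OF ob(3)]
  have hg: "h \<cdot>\<^bsub>C\<^esub> g \<in> hom C (T \<bullet>\<^sub>o (a', b)) c'"
    by (rule C.comp_in_hom[OF g h])
  note Tk = T_hom[OF ide(1) k] and Tf = T_hom[OF f ide(3)]
  note \<eta> = unit_in_hom[OF ob(1,3)] and \<eta>' = unit_in_hom[OF ob(2,3)] and \<eta>b' = unit_in_hom[OF ob(1,4)]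
  note HTk = H_hom[OF ide(1) Tk] and HTf = H_hom[OF ide(1) Tf] and Hhg = H_hom[OF ide(1) hg]
  note HfT = H_hom[OF f C.ide_in_hom[OF T_Ob[OF ob(2,3)]]]
  note Hg = H_hom[OF ide(2) g] and Hfh = H_hom[OF f h]
  have "right_transpose a b' (h \<cdot>\<^bsub>C\<^esub> g \<cdot>\<^bsub>C\<^esub> T \<bullet>\<^sub>a (f, k))
      = H \<bullet>\<^sub>a (Ide A a, h \<cdot>\<^bsub>C\<^esub> g \<cdot>\<^bsub>C\<^esub> (T \<bullet>\<^sub>a (f, Ide B b) \<cdot>\<^bsub>C\<^esub> T \<bullet>\<^sub>a (Ide A a, k))) \<cdot>\<^bsub>B\<^esub> \<eta> (a, b')"
    unfolding right_transpose_def T_split[OF f k] ..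
  also have "\<dots> = H \<bullet>\<^sub>a (Ide A a, h \<cdot>\<^bsub>C\<^esub> g) \<cdot>\<^bsub>B\<^esub> (H \<bullet>\<^sub>a (Ide A a, T \<bullet>\<^sub>a (f, Ide B b))
      \<cdot>\<^bsub>B\<^esub> (H \<bullet>\<^sub>a (Ide A a, T \<bullet>\<^sub>a (Ide A a, k)) \<cdot>\<^bsub>B\<^esub> \<eta> (a, b')))"
    by (simp add: H_comp_right[OF ob(1) C.comp_in_hom[OF Tk Tf] hg] H_comp_right[OF ob(1) Tk Tf]
        B.comp_assoc[OF \<eta>b' HTk HTf] B.comp_assoc[OF \<eta>b' B.comp_in_hom[OF HTk HTf] Hhg])
  also have "\<dots> = H \<bullet>\<^sub>a (Ide A a, h \<cdot>\<^bsub>C\<^esub> g)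
      \<cdot>\<^bsub>B\<^esub> (H \<bullet>\<^sub>a (Ide A a, T \<bullet>\<^sub>a (f, Ide B b)) \<cdot>\<^bsub>B\<^esub> \<eta> (a, b) \<cdot>\<^bsub>B\<^esub> k)"
    by (simp add: unit_natural[OF ob(1) k, symmetric] B.comp_assoc[OF k \<eta> HTf])
  also have "\<dots> = H \<bullet>\<^sub>a (Ide A a, h \<cdot>\<^bsub>C\<^esub> g)
      \<cdot>\<^bsub>B\<^esub> (H \<bullet>\<^sub>a (f, Ide C (T \<bullet>\<^sub>o (a', b))) \<cdot>\<^bsub>B\<^esub> \<eta> (a', b) \<cdot>\<^bsub>B\<^esub> k)"
    by (simp add: unit_extranatural[OF f ob(3)])
  also have "\<dots> = H \<bullet>\<^sub>a (f, h \<cdot>\<^bsub>C\<^esub> g) \<cdot>\<^bsub>B\<^esub> \<eta> (a', b) \<cdot>\<^bsub>B\<^esub> k"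
    by (simp add: H_split[OF f hg] B.comp_assoc[OF k B.comp_in_hom[OF \<eta>' HfT] Hhg]
        B.comp_assoc[OF \<eta>' HfT Hhg])
  also have "H \<bullet>\<^sub>a (f, h \<cdot>\<^bsub>C\<^esub> g) = H \<bullet>\<^sub>a (f, h) \<cdot>\<^bsub>B\<^esub> H \<bullet>\<^sub>a (Ide A a', g)"
    using H_comp[OF f ide(2) g h] by (simp add: A.comp_ide_left[OF f])
  also have "\<dots> \<cdot>\<^bsub>B\<^esub> \<eta> (a', b) = H \<bullet>\<^sub>a (f, h) \<cdot>\<^bsub>B\<^esub> right_transpose a' b g"
    by (simp add: right_transpose_def B.comp_assoc[OF \<eta>' Hg Hfh])
  finally show ?thesis .
qed

lemma right_transpose_comp_T:
  assumes f: "f \<in> hom A a a'" and k: "k \<in> hom B b' b" and g: "g \<in> hom C (T \<bullet>\<^sub>o (a', b)) c"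
  shows "right_transpose a b' (g \<cdot>\<^bsub>C\<^esub> T \<bullet>\<^sub>a (f, k))
    = H \<bullet>\<^sub>a (f, Ide C c) \<cdot>\<^bsub>B\<^esub> right_transpose a' b g \<cdot>\<^bsub>B\<^esub> k"
  using right_transpose_natural[OF f k g C.ide_in_hom] C.hom_Ob[OF g] C.comp_ide_left[OF g] by simp

lemma right_transpose_comp:
  assumes a: "a \<in> Ob A" and k: "k \<in> hom B b' b" and g: "g \<in> hom C (T \<bullet>\<^sub>o (a, b)) c"
  shows "right_transpose a b' (g \<cdot>\<^bsub>C\<^esub> T \<bullet>\<^sub>a (Ide A a, k)) = right_transpose a b g \<cdot>\<^bsub>B\<^esub> k"
  using right_transpose_comp_T[OF A.ide_in_hom[OF a] k g] a B.hom_Ob[OF k] C.hom_Ob[OF g]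
    B.comp_ide_left[OF right_transpose_hom[OF a _ g]]
  by (simp add: H_ide)

lemma right_transpose_left_transpose:
  assumes a: "a \<in> Ob A" and c: "c \<in> Ob C" and m: "m \<in> hom B b (H \<bullet>\<^sub>o (a, c))"
  shows "right_transpose a b (left_transpose a c m) = m"
  unfolding left_transpose_def right_transpose_comp[OF a m counit_in_hom[OF a c]]
  by (simp add: right_transpose_def triangle_right[OF a c] B.comp_ide_left[OF m])

lemma left_transpose_right_transpose:
  assumes a: "a \<in> Ob A" and b: "b \<in> Ob B" and g: "g \<in> hom C (T \<bullet>\<^sub>o (a, b)) c"
  shows "left_transpose a c (right_transpose a b g) = g"
proof -
  note c = C.hom_Ob(2)[OF g] and T = T_Ob[OF a b]
  note \<eta> = unit_in_hom[OF a b] and Hg = H_hom[OF A.ide_in_hom[OF a] g]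
  have "left_transpose a c (right_transpose a b g)
      = \<epsilon> (a, c) \<cdot>\<^bsub>C\<^esub> T \<bullet>\<^sub>a (Ide A a, H \<bullet>\<^sub>a (Ide A a, g)) \<cdot>\<^bsub>C\<^esub> T \<bullet>\<^sub>a (Ide A a, \<eta> (a, b))"
    unfolding left_transpose_def right_transpose_def T_comp_right[OF a \<eta> Hg]
    by (rule C.comp_assoc[OF T_hom[OF A.ide_in_hom[OF a] \<eta>] T_hom[OF A.ide_in_hom[OF a] Hg]
          counit_in_hom[OF a c]])
  also have "\<dots> = g \<cdot>\<^bsub>C\<^esub> (\<epsilon> (a, T \<bullet>\<^sub>o (a, b)) \<cdot>\<^bsub>C\<^esub> T \<bullet>\<^sub>a (Ide A a, \<eta> (a, b)))"
    by (simp add: counit_natural[OF a g]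
        C.comp_assoc[OF T_hom[OF A.ide_in_hom[OF a] \<eta>] counit_in_hom[OF a T] g])
  also have "\<dots> = g"
    by (simp add: triangle_left[OF a b] C.comp_ide_right[OF g])
  finally show ?thesis .
qed

text \<open>Naturality passes to the inverse bijection: both sides have the same right transpose.\<close>

lemma left_transpose_natural:
  assumes f: "f \<in> hom A a a'" and k: "k \<in> hom B b' b"
    and m: "m \<in> hom B b (H \<bullet>\<^sub>o (a', c))" and h: "h \<in> hom C c c'"
  shows "left_transpose a c' (H \<bullet>\<^sub>a (f, h) \<cdot>\<^bsub>B\<^esub> m \<cdot>\<^bsub>B\<^esub> k)
    = h \<cdot>\<^bsub>C\<^esub> left_transpose a' c m \<cdot>\<^bsub>C\<^esub> T \<bullet>\<^sub>a (f, k)"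
proof -
  have ob: "a \<in> Ob A" "a' \<in> Ob A" "b' \<in> Ob B" "c \<in> Ob C"
    using f k h A.hom_Ob B.hom_Ob C.hom_Ob by blast+
  note lm = left_transpose_hom[OF ob(2,4) m]
  have "H \<bullet>\<^sub>a (f, h) \<cdot>\<^bsub>B\<^esub> m \<cdot>\<^bsub>B\<^esub> k
      = right_transpose a b' (h \<cdot>\<^bsub>C\<^esub> left_transpose a' c m \<cdot>\<^bsub>C\<^esub> T \<bullet>\<^sub>a (f, k))"
    by (simp add: right_transpose_natural[OF f k lm h] right_transpose_left_transpose[OF ob(2,4) m])
  then show ?thesis
    using left_transpose_right_transpose[OF ob(1,3)
        C.comp_in_hom[OF T_hom[OF f k] C.comp_in_hom[OF lm h]]]
    by simp
qed

lemma left_transpose_H_comp: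
  assumes a: "a \<in> Ob A" and m: "m \<in> hom B b (H \<bullet>\<^sub>o (a, c))" and h: "h \<in> hom C c c'"
  shows "left_transpose a c' (H \<bullet>\<^sub>a (Ide A a, h) \<cdot>\<^bsub>B\<^esub> m) = h \<cdot>\<^bsub>C\<^esub> left_transpose a c m"
proof -
  note b = B.hom_Ob(1)[OF m] and c = C.hom_Ob(1)[OF h]
  show ?thesis
    using left_transpose_natural[OF A.ide_in_hom[OF a] B.ide_in_hom[OF b] m h] a b
      B.comp_ide_right[OF B.comp_in_hom[OF m H_hom[OF A.ide_in_hom[OF a] h]]]
      C.comp_ide_right[OF C.comp_in_hom[OF left_transpose_hom[OF a c m] h]]
    by (simp add: T_ide)
qed

lemma right_transpose_T:
  assumes f: "f \<in> hom A a a'" and k: "k \<in> hom B b' b"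
  shows "right_transpose a b' (T \<bullet>\<^sub>a (f, k)) = H \<bullet>\<^sub>a (f, Ide C (T \<bullet>\<^sub>o (a', b))) \<cdot>\<^bsub>B\<^esub> \<eta> (a', b) \<cdot>\<^bsub>B\<^esub> k"
proof -
  note ob = A.hom_Ob(2)[OF f] B.hom_Ob(2)[OF k]
  show ?thesis
    using right_transpose_comp_T[OF f k C.ide_in_hom[OF T_Ob[OF ob]]]
    by (simp add: right_transpose_ide[OF ob] C.comp_ide_left[OF T_hom[OF f k]])
qed

lemma left_transpose_H:
  assumes f: "f \<in> hom A a a'" and h: "h \<in> hom C c c'"
  shows "left_transpose a c' (H \<bullet>\<^sub>a (f, h))
    = h \<cdot>\<^bsub>C\<^esub> \<epsilon> (a', c) \<cdot>\<^bsub>C\<^esub> T \<bullet>\<^sub>a (f, Ide B (H \<bullet>\<^sub>o (a', c)))"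
proof -
  note ob = A.hom_Ob(2)[OF f] C.hom_Ob(1)[OF h]
  note ide = B.ide_in_hom[OF H_Ob[OF ob]]
  show ?thesis
    using left_transpose_natural[OF f ide ide h]
    by (simp add: left_transpose_ide[OF ob] B.comp_ide_right[OF H_hom[OF f h]])
qed

end

section \<open>Conjugation\<close>

locale conjugation =
  adj: left_adjunction2 A B C T H \<epsilon> \<eta> + adj': left_adjunction2 A B C T' H' \<epsilon>' \<eta>'
  for A :: "('oa, 'ma) category" and B :: "('ob, 'mb) category" and C :: "('oc, 'mc) category"
    and T T' :: "('oa \<times> 'ob, 'ma \<times> 'mb, 'oc, 'mc) cat_functor"
    and H H' :: "('oa \<times> 'oc, 'ma \<times> 'mc, 'ob, 'mb) cat_functor"
    and \<epsilon> \<epsilon>' :: "'oa \<times> 'oc \<Rightarrow> 'mc" and \<eta> \<eta>' :: "'oa \<times> 'ob \<Rightarrow> 'mb"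
begin

abbreviation "Nat_T \<equiv> nat_trans (prod_cat A B) C T T'"
abbreviation "Nat_H \<equiv> nat_trans (prod_cat (op_cat A) C) B H' H"
abbreviation "j\<^sub>l \<equiv> conj_left A B C H \<eta> H' \<epsilon>'"
abbreviation "j\<^sub>r \<equiv> conj_right A B C T \<epsilon> T' \<eta>'"

lemma Nat_T_hom:
  "\<lbrakk>\<theta> \<in> Nat_T; a \<in> Ob A; b \<in> Ob B\<rbrakk> \<Longrightarrow> \<theta> (a, b) \<in> hom C (T \<bullet>\<^sub>o (a, b)) (T' \<bullet>\<^sub>o (a, b))"
  by (simp add: nat_trans_def)

lemma Nat_H_hom:
  "\<lbrakk>\<phi> \<in> Nat_H; a \<in> Ob A; c \<in> Ob C\<rbrakk> \<Longrightarrow> \<phi> (a, c) \<in> hom B (H' \<bullet>\<^sub>o (a, c)) (H \<bullet>\<^sub>o (a, c))"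
  by (simp add: nat_trans_def)

lemma Nat_T_natural:
  assumes "\<theta> \<in> Nat_T" and f: "f \<in> hom A a a'" and k: "k \<in> hom B b b'"
  shows "\<theta> (a', b') \<cdot>\<^bsub>C\<^esub> T \<bullet>\<^sub>a (f, k) = T' \<bullet>\<^sub>a (f, k) \<cdot>\<^bsub>C\<^esub> \<theta> (a, b)"
proof -
  have "(a, b) \<in> Ob (prod_cat A B)" "(a', b') \<in> Ob (prod_cat A B)"
    "(f, k) \<in> hom (prod_cat A B) (a, b) (a', b')"
    using f k adj.A.hom_Ob adj.B.hom_Ob by auto
  then show ?thesis
    using assms(1) unfolding nat_trans_def by blast
qed

lemma Nat_H_natural:
  assumes "\<phi> \<in> Nat_H" and f: "f \<in> hom A a a'" and h: "h \<in> hom C c c'"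
  shows "\<phi> (a, c') \<cdot>\<^bsub>B\<^esub> H' \<bullet>\<^sub>a (f, h) = H \<bullet>\<^sub>a (f, h) \<cdot>\<^bsub>B\<^esub> \<phi> (a', c)"
proof -
  have "(a', c) \<in> Ob (prod_cat (op_cat A) C)" "(a, c') \<in> Ob (prod_cat (op_cat A) C)"
    "(f, h) \<in> hom (prod_cat (op_cat A) C) (a', c) (a, c')"
    using f h adj.A.hom_Ob adj.C.hom_Ob by auto
  then show ?thesis
    using assms(1) unfolding nat_trans_def by blast
qed

lemma conj_left_eq_right_transpose:
  assumes \<theta>: "\<theta> \<in> Nat_T" and a: "a \<in> Ob A" and c: "c \<in> Ob C"
  shows "j\<^sub>l \<theta> (a, c)
    = adj.right_transpose a (H' \<bullet>\<^sub>o (a, c)) (\<epsilon>' (a, c) \<cdot>\<^bsub>C\<^esub> \<theta> (a, H' \<bullet>\<^sub>o (a, c)))"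
  using a c
  by (simp add: conj_left_def adj.right_transpose_def
      adj.H_comp_right[OF a Nat_T_hom[OF \<theta> a adj'.H_Ob[OF a c]] adj'.counit_in_hom[OF a c]])

lemma conj_right_eq_left_transpose:
  assumes \<phi>: "\<phi> \<in> Nat_H" and a: "a \<in> Ob A" and b: "b \<in> Ob B"
  shows "j\<^sub>r \<phi> (a, b)
    = adj.left_transpose a (T' \<bullet>\<^sub>o (a, b)) (\<phi> (a, T' \<bullet>\<^sub>o (a, b)) \<cdot>\<^bsub>B\<^esub> \<eta>' (a, b))"
proof -
  note T' = adj'.T_Ob[OF a b] and ide = adj.A.ide_in_hom[OF a]
  note \<eta>' = adj'.unit_in_hom[OF a b] and \<phi>T' = Nat_H_hom[OF \<phi> a T']
  show ?thesis
    using a b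
    by (simp add: conj_right_def adj.left_transpose_def adj.T_comp_right[OF a \<eta>' \<phi>T']
        adj.C.comp_assoc[OF adj.T_hom[OF ide \<eta>'] adj.T_hom[OF ide \<phi>T'] adj.counit_in_hom[OF a T']])
qed

lemma conj_left_hom:
  assumes \<theta>: "\<theta> \<in> Nat_T" and a: "a \<in> Ob A" and c: "c \<in> Ob C"
  shows "j\<^sub>l \<theta> (a, c) \<in> hom B (H' \<bullet>\<^sub>o (a, c)) (H \<bullet>\<^sub>o (a, c))"
  unfolding conj_left_eq_right_transpose[OF assms]
  by (rule adj.right_transpose_hom[OF a adj'.H_Ob[OF a c]
        adj.C.comp_in_hom[OF Nat_T_hom[OF \<theta> a adj'.H_Ob[OF a c]] adj'.counit_in_hom[OF a c]]])

lemma conj_right_hom: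
  assumes \<phi>: "\<phi> \<in> Nat_H" and a: "a \<in> Ob A" and b: "b \<in> Ob B"
  shows "j\<^sub>r \<phi> (a, b) \<in> hom C (T \<bullet>\<^sub>o (a, b)) (T' \<bullet>\<^sub>o (a, b))"
  unfolding conj_right_eq_left_transpose[OF assms]
  by (rule adj.left_transpose_hom[OF a adj'.T_Ob[OF a b]
        adj.B.comp_in_hom[OF adj'.unit_in_hom[OF a b] Nat_H_hom[OF \<phi> a adj'.T_Ob[OF a b]]]])

text \<open>Under transposition, \<open>g \<mapsto> g \<circ> \<theta>\<close> becomes postcomposition with \<open>j\<^sub>l(\<theta>)\<close>, since
  \<open>g = \<epsilon>' \<circ> T'(a, m)\<close> for the transpose \<open>m\<close> of \<open>g\<close> and \<open>\<theta>\<close> commutes past \<open>T'(a, m)\<close>.\<close>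

lemma conj_left_right_transpose:
  assumes \<theta>: "\<theta> \<in> Nat_T" and a: "a \<in> Ob A" and b: "b \<in> Ob B"
    and g: "g \<in> hom C (T' \<bullet>\<^sub>o (a, b)) c"
  shows "j\<^sub>l \<theta> (a, c) \<cdot>\<^bsub>B\<^esub> adj'.right_transpose a b g = adj.right_transpose a b (g \<cdot>\<^bsub>C\<^esub> \<theta> (a, b))"
proof -
  let ?m = "adj'.right_transpose a b g"
  note c = adj.C.hom_Ob(2)[OF g] and ide = adj.A.ide_in_hom[OF a]
  note m = adj'.right_transpose_hom[OF a b g] and \<epsilon>' = adj'.counit_in_hom[OF a c]
  note \<theta>H' = Nat_T_hom[OF \<theta> a adj'.H_Ob[OF a c]] and \<theta>b = Nat_T_hom[OF \<theta> a b]
  have "j\<^sub>l \<theta> (a, c) \<cdot>\<^bsub>B\<^esub> ?m = adj.right_transpose a b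
      (\<epsilon>' (a, c) \<cdot>\<^bsub>C\<^esub> \<theta> (a, H' \<bullet>\<^sub>o (a, c)) \<cdot>\<^bsub>C\<^esub> T \<bullet>\<^sub>a (Ide A a, ?m))"
    unfolding conj_left_eq_right_transpose[OF \<theta> a c]
    by (rule adj.right_transpose_comp[OF a m adj.C.comp_in_hom[OF \<theta>H' \<epsilon>'], symmetric])
  also have "\<epsilon>' (a, c) \<cdot>\<^bsub>C\<^esub> \<theta> (a, H' \<bullet>\<^sub>o (a, c)) \<cdot>\<^bsub>C\<^esub> T \<bullet>\<^sub>a (Ide A a, ?m)
      = \<epsilon>' (a, c) \<cdot>\<^bsub>C\<^esub> (T' \<bullet>\<^sub>a (Ide A a, ?m) \<cdot>\<^bsub>C\<^esub> \<theta> (a, b))"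
    by (simp add: Nat_T_natural[OF \<theta> ide m, symmetric]
        adj.C.comp_assoc[OF adj.T_hom[OF ide m] \<theta>H' \<epsilon>'])
  also have "\<dots> = adj'.left_transpose a c ?m \<cdot>\<^bsub>C\<^esub> \<theta> (a, b)"
    by (simp add: adj'.left_transpose_def adj.C.comp_assoc[OF \<theta>b adj'.T_hom[OF ide m] \<epsilon>'])
  finally show ?thesis
    by (simp add: adj'.left_transpose_right_transpose[OF a b g])
qed

text \<open>Dually, \<open>m = H'(a, g) \<circ> \<eta>'\<close> for the transpose \<open>g\<close> of \<open>m\<close>, and \<open>\<phi>\<close> commutes past
  \<open>H'(a, g)\<close>.\<close>

lemma left_transpose_conj_right:
  assumes \<phi>: "\<phi> \<in> Nat_H" and a: "a \<in> Ob A" and c: "c \<in> Ob C"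
    and m: "m \<in> hom B b (H' \<bullet>\<^sub>o (a, c))"
  shows "adj'.left_transpose a c m \<cdot>\<^bsub>C\<^esub> j\<^sub>r \<phi> (a, b) = adj.left_transpose a c (\<phi> (a, c) \<cdot>\<^bsub>B\<^esub> m)"
proof -
  let ?g = "adj'.left_transpose a c m"
  note b = adj.B.hom_Ob(1)[OF m] and ide = adj.A.ide_in_hom[OF a]
  note g = adj'.left_transpose_hom[OF a c m] and \<eta>' = adj'.unit_in_hom[OF a b]
  note \<phi>T' = Nat_H_hom[OF \<phi> a adj'.T_Ob[OF a b]] and \<phi>c = Nat_H_hom[OF \<phi> a c]
  have "?g \<cdot>\<^bsub>C\<^esub> j\<^sub>r \<phi> (a, b) = adj.left_transpose a c
      (H \<bullet>\<^sub>a (Ide A a, ?g) \<cdot>\<^bsub>B\<^esub> (\<phi> (a, T' \<bullet>\<^sub>o (a, b)) \<cdot>\<^bsub>B\<^esub> \<eta>' (a, b)))"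
    unfolding conj_right_eq_left_transpose[OF \<phi> a b]
    by (rule adj.left_transpose_H_comp[OF a adj.B.comp_in_hom[OF \<eta>' \<phi>T'] g, symmetric])
  also have "H \<bullet>\<^sub>a (Ide A a, ?g) \<cdot>\<^bsub>B\<^esub> (\<phi> (a, T' \<bullet>\<^sub>o (a, b)) \<cdot>\<^bsub>B\<^esub> \<eta>' (a, b))
      = \<phi> (a, c) \<cdot>\<^bsub>B\<^esub> H' \<bullet>\<^sub>a (Ide A a, ?g) \<cdot>\<^bsub>B\<^esub> \<eta>' (a, b)"
    by (simp add: Nat_H_natural[OF \<phi> ide g] adj.B.comp_assoc[OF \<eta>' \<phi>T' adj.H_hom[OF ide g]])
  also have "\<dots> = \<phi> (a, c) \<cdot>\<^bsub>B\<^esub> adj'.right_transpose a b ?g"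
    by (simp add: adj'.right_transpose_def adj.B.comp_assoc[OF \<eta>' adj'.H_hom[OF ide g] \<phi>c])
  finally show ?thesis
    by (simp add: adj'.right_transpose_left_transpose[OF a c m])
qed

text \<open>\<open>H'(f, h)\<close> is the transpose of \<open>h \<circ> \<epsilon>' \<circ> T'(f, H'(a', c))\<close>, so \<open>j\<^sub>l(\<theta>) \<circ> H'(f, h)\<close> is the
  transpose of \<open>h \<circ> \<epsilon>' \<circ> T'(f, H'(a', c)) \<circ> \<theta> = h \<circ> \<epsilon>' \<circ> \<theta> \<circ> T(f, H'(a', c))\<close>, and naturality of
  transposition takes \<open>f\<close> and \<open>h\<close> out again.\<close>

lemma conj_left_natural:
  assumes \<theta>: "\<theta> \<in> Nat_T" and f: "f \<in> hom A a a'" and h: "h \<in> hom C c c'"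
  shows "j\<^sub>l \<theta> (a, c') \<cdot>\<^bsub>B\<^esub> H' \<bullet>\<^sub>a (f, h) = H \<bullet>\<^sub>a (f, h) \<cdot>\<^bsub>B\<^esub> j\<^sub>l \<theta> (a', c)"
proof -
  have ob: "a \<in> Ob A" "a' \<in> Ob A" "c \<in> Ob C" "c' \<in> Ob C"
    using f h adj.A.hom_Ob adj.C.hom_Ob by blast+
  let ?b = "H' \<bullet>\<^sub>o (a', c)"
  let ?g = "adj'.left_transpose a c' (H' \<bullet>\<^sub>a (f, h))"
  note b = adj'.H_Ob[OF ob(2,3)] and H'fh = adj'.H_hom[OF f h]
  note ide = adj.B.ide_in_hom[OF b] and g = adj'.left_transpose_hom[OF ob(1,4) H'fh]
  note \<epsilon>' = adj'.counit_in_hom[OF ob(2,3)]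
  note \<theta>a = Nat_T_hom[OF \<theta> ob(1) b] and \<theta>a' = Nat_T_hom[OF \<theta> ob(2) b]
  note \<epsilon>'\<theta> = adj.C.comp_in_hom[OF \<theta>a' \<epsilon>']
  have "?g \<cdot>\<^bsub>C\<^esub> \<theta> (a, ?b) = h \<cdot>\<^bsub>C\<^esub> \<epsilon>' (a', c) \<cdot>\<^bsub>C\<^esub> (T' \<bullet>\<^sub>a (f, Ide B ?b) \<cdot>\<^bsub>C\<^esub> \<theta> (a, ?b))"
    by (simp add: adj'.left_transpose_H[OF f h]
        adj.C.comp_assoc[OF \<theta>a adj'.T_hom[OF f ide] adj.C.comp_in_hom[OF \<epsilon>' h]])
  also have "\<dots> = h \<cdot>\<^bsub>C\<^esub> (\<epsilon>' (a', c) \<cdot>\<^bsub>C\<^esub> \<theta> (a', ?b)) \<cdot>\<^bsub>C\<^esub> T \<bullet>\<^sub>a (f, Ide B ?b)"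
    by (simp add: Nat_T_natural[OF \<theta> f ide, symmetric] adj.C.comp_assoc[OF \<theta>a' \<epsilon>' h]
        adj.C.comp_assoc[OF adj.T_hom[OF f ide] \<theta>a' adj.C.comp_in_hom[OF \<epsilon>' h]])
  finally have "adj.right_transpose a ?b (?g \<cdot>\<^bsub>C\<^esub> \<theta> (a, ?b))
      = H \<bullet>\<^sub>a (f, h) \<cdot>\<^bsub>B\<^esub> j\<^sub>l \<theta> (a', c) \<cdot>\<^bsub>B\<^esub> Ide B ?b"
    by (simp add: adj.right_transpose_natural[OF f ide \<epsilon>'\<theta> h]
        conj_left_eq_right_transpose[OF \<theta> ob(2,3)])
  then show ?thesis
    using conj_left_right_transpose[OF \<theta> ob(1) b g]
    by (simp add: adj'.right_transpose_left_transpose[OF ob(1,4) H'fh]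
        adj.B.comp_ide_right[OF adj.B.comp_in_hom[OF conj_left_hom[OF \<theta> ob(2,3)] adj.H_hom[OF f h]]])
qed

text \<open>Dually, \<open>T'(f, k)\<close> has transpose \<open>H'(f, T'(a', b')) \<circ> \<eta>' \<circ> k\<close>, and \<open>\<phi>\<close> commutes past
  \<open>H'(f, T'(a', b'))\<close>.\<close>

lemma conj_right_natural:
  assumes \<phi>: "\<phi> \<in> Nat_H" and f: "f \<in> hom A a a'" and k: "k \<in> hom B b b'"
  shows "j\<^sub>r \<phi> (a', b') \<cdot>\<^bsub>C\<^esub> T \<bullet>\<^sub>a (f, k) = T' \<bullet>\<^sub>a (f, k) \<cdot>\<^bsub>C\<^esub> j\<^sub>r \<phi> (a, b)"
proof -
  have ob: "a \<in> Ob A" "a' \<in> Ob A" "b \<in> Ob B" "b' \<in> Ob B"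
    using f k adj.A.hom_Ob adj.B.hom_Ob by blast+
  let ?c = "T' \<bullet>\<^sub>o (a', b')"
  let ?m = "adj'.right_transpose a b (T' \<bullet>\<^sub>a (f, k))"
  note c = adj'.T_Ob[OF ob(2,4)] and T'fk = adj'.T_hom[OF f k]
  note ide = adj.C.ide_in_hom[OF c] and m = adj'.right_transpose_hom[OF ob(1,3) T'fk]
  note \<eta>' = adj'.unit_in_hom[OF ob(2,4)] and H'f = adj'.H_hom[OF f ide] and Hf = adj.H_hom[OF f ide]
  note \<phi>a = Nat_H_hom[OF \<phi> ob(1) c] and \<phi>a' = Nat_H_hom[OF \<phi> ob(2) c]
  note \<phi>\<eta>' = adj.B.comp_in_hom[OF \<eta>' \<phi>a']
  have "\<phi> (a, ?c) \<cdot>\<^bsub>B\<^esub> ?m = \<phi> (a, ?c) \<cdot>\<^bsub>B\<^esub> H' \<bullet>\<^sub>a (f, Ide C ?c) \<cdot>\<^bsub>B\<^esub> \<eta>' (a', b') \<cdot>\<^bsub>B\<^esub> k"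
    by (simp add: adj'.right_transpose_T[OF f k] adj.B.comp_assoc[OF \<eta>' H'f \<phi>a]
        adj.B.comp_assoc[OF k adj.B.comp_in_hom[OF \<eta>' H'f] \<phi>a])
  also have "\<dots> = H \<bullet>\<^sub>a (f, Ide C ?c) \<cdot>\<^bsub>B\<^esub> (\<phi> (a', ?c) \<cdot>\<^bsub>B\<^esub> \<eta>' (a', b')) \<cdot>\<^bsub>B\<^esub> k"
    by (simp add: Nat_H_natural[OF \<phi> f ide] adj.B.comp_assoc[OF \<eta>' \<phi>a' Hf])
  finally have "adj.left_transpose a ?c (\<phi> (a, ?c) \<cdot>\<^bsub>B\<^esub> ?m)
      = Ide C ?c \<cdot>\<^bsub>C\<^esub> j\<^sub>r \<phi> (a', b') \<cdot>\<^bsub>C\<^esub> T \<bullet>\<^sub>a (f, k)"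
    by (simp add: adj.left_transpose_natural[OF f k \<phi>\<eta>' ide]
        conj_right_eq_left_transpose[OF \<phi> ob(2,4)])
  then show ?thesis
    using left_transpose_conj_right[OF \<phi> ob(1) c m]
    by (simp add: adj'.left_transpose_right_transpose[OF ob(1,3) T'fk]
        adj.C.comp_ide_left[OF conj_right_hom[OF \<phi> ob(2,4)]])
qed

lemma conj_left_Nat: "\<theta> \<in> Nat_T \<Longrightarrow> j\<^sub>l \<theta> \<in> Nat_H"
  unfolding nat_trans_def[of "prod_cat (op_cat A) C"]
  by (auto simp: conj_left_hom conj_left_natural) (simp add: conj_left_def)

lemma conj_right_Nat: "\<phi> \<in> Nat_H \<Longrightarrow> j\<^sub>r \<phi> \<in> Nat_T"
  unfolding nat_trans_def[of "prod_cat A B"]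
  by (auto simp: conj_right_hom conj_right_natural) (simp add: conj_right_def)

lemma conj_right_conj_left:
  assumes \<theta>: "\<theta> \<in> Nat_T"
  shows "j\<^sub>r (j\<^sub>l \<theta>) = \<theta>"
proof (rule extensionalityI[where A = "Ob A \<times> Ob B"])
  show "j\<^sub>r (j\<^sub>l \<theta>) \<in> extensional (Ob A \<times> Ob B)" "\<theta> \<in> extensional (Ob A \<times> Ob B)"
    using \<theta> conj_right_Nat[OF conj_left_Nat[OF \<theta>]] by (simp_all add: nat_trans_def)
  fix x assume "x \<in> Ob A \<times> Ob B"
  then obtain a b where x: "x = (a, b)" and a: "a \<in> Ob A" and b: "b \<in> Ob B" by blast
  let ?c = "T' \<bullet>\<^sub>o (a, b)"
  note \<theta>ab = Nat_T_hom[OF \<theta> a b]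
  (* eta' is the transpose of an identity. *)
  have "j\<^sub>l \<theta> (a, ?c) \<cdot>\<^bsub>B\<^esub> \<eta>' (a, b) = adj.right_transpose a b (\<theta> (a, b))"
    using conj_left_right_transpose[OF \<theta> a b adj.C.ide_in_hom[OF adj'.T_Ob[OF a b]]]
    by (simp add: adj'.right_transpose_ide[OF a b] adj.C.comp_ide_left[OF \<theta>ab])
  then show "j\<^sub>r (j\<^sub>l \<theta>) x = \<theta> x"
    by (simp add: x conj_right_eq_left_transpose[OF conj_left_Nat[OF \<theta>] a b]
        adj.left_transpose_right_transpose[OF a b \<theta>ab])
qed

lemma conj_left_conj_right:
  assumes \<phi>: "\<phi> \<in> Nat_H"
  shows "j\<^sub>l (j\<^sub>r \<phi>) = \<phi>"
proof (rule extensionalityI[where A = "Ob A \<times> Ob C"])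
  show "j\<^sub>l (j\<^sub>r \<phi>) \<in> extensional (Ob A \<times> Ob C)" "\<phi> \<in> extensional (Ob A \<times> Ob C)"
    using \<phi> conj_left_Nat[OF conj_right_Nat[OF \<phi>]] by (simp_all add: nat_trans_def)
  fix x assume "x \<in> Ob A \<times> Ob C"
  then obtain a c where x: "x = (a, c)" and a: "a \<in> Ob A" and c: "c \<in> Ob C" by blast
  let ?b = "H' \<bullet>\<^sub>o (a, c)"
  note \<phi>ac = Nat_H_hom[OF \<phi> a c]
  (* epsilon' is the transpose of an identity. *)
  have "\<epsilon>' (a, c) \<cdot>\<^bsub>C\<^esub> j\<^sub>r \<phi> (a, ?b) = adj.left_transpose a c (\<phi> (a, c))"
    using left_transpose_conj_right[OF \<phi> a c adj.B.ide_in_hom[OF adj'.H_Ob[OF a c]]]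
    by (simp add: adj'.left_transpose_ide[OF a c] adj.B.comp_ide_right[OF \<phi>ac])
  then show "j\<^sub>l (j\<^sub>r \<phi>) x = \<phi> x"
    by (simp add: x conj_left_eq_right_transpose[OF conj_right_Nat[OF \<phi>] a c]
        adj.right_transpose_left_transpose[OF a c \<phi>ac])
qed

end

theorem proposition4p3:
  fixes A :: "('oa, 'ma) category" and B :: "('ob, 'mb) category" and C :: "('oc, 'mc) category"
    and T T' :: "('oa \<times> 'ob, 'ma \<times> 'mb, 'oc, 'mc) cat_functor"
    and H H' :: "('oa \<times> 'oc, 'ma \<times> 'mc, 'ob, 'mb) cat_functor"
    and \<epsilon> \<epsilon>' :: "'oa \<times> 'oc \<Rightarrow> 'mc" and \<eta> \<eta>' :: "'oa \<times> 'ob \<Rightarrow> 'mb"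
  assumes "left_adjunction2 A B C T H \<epsilon> \<eta>"
    and "left_adjunction2 A B C T' H' \<epsilon>' \<eta>'"
  shows "let j\<^sub>l = conj_left A B C H \<eta> H' \<epsilon>'; j\<^sub>r = conj_right A B C T \<epsilon> T' \<eta>' in
    j\<^sub>l \<in> nat_trans (prod_cat A B) C T T' \<rightarrow> nat_trans (prod_cat (op_cat A) C) B H' H \<and>
    j\<^sub>r \<in> nat_trans (prod_cat (op_cat A) C) B H' H \<rightarrow> nat_trans (prod_cat A B) C T T' \<and>
    (\<forall>\<theta> \<in> nat_trans (prod_cat A B) C T T'. j\<^sub>r (j\<^sub>l \<theta>) = \<theta>) \<and>
    (\<forall>\<phi> \<in> nat_trans (prod_cat (op_cat A) C) B H' H. j\<^sub>l (j\<^sub>r \<phi>) = \<phi>)"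
proof -
  interpret conjugation A B C T T' H H' \<epsilon> \<epsilon>' \<eta> \<eta>'
    using assms by (rule conjugation.intro)
  show ?thesis
    using conj_left_Nat conj_right_Nat conj_right_conj_left conj_left_conj_right
    by (simp add: Let_def Pi_iff)
qed

end
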